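(* Let $\mathsf n\ge 1$ and $\mathsf m\ge 1$ be integers, $\rho\in(0,1)$, $\mathsf P_l\in[0,1)$. Consider $\mathsf n$ nodes operating under irregular repetition slotted ALOHA (IRSA) with frames of $\mathsf m$ slots, per-slot activation probability $\rho$, packet loss rate $\mathsf P_l$ and aggregate throughput $\mathsf S=\frac{\mathsf n[1-(1-\rho)^{\mathsf m}]}{\mathsf m}(1-\mathsf P_l)$. For a given node, let $\Omega_k=\delta(k\mathsf m)-(\mathsf m+1)$, $k\in\mathbb N_0$, be the offset of its current age of information at the start of frame $k$ with respect to its minimum possible value $\mathsf m+1$; this is a Markov chain on $\mathbb N_0$ whose transition probabilities are given in the context. Then $\Omega_k$ is ergodic (irreducible, aperiodic and positive recurrent), and its steady-state distribution is $$\pi_\omega=\frac{\mathsf m\mathsf S}{\mathsf n}\left(1-\frac{\mathsf m\mathsf S}{\mathsf n}\right)^{\beta_\omega}\cdot\frac{\rho(1-\rho)^{\alpha_\omega}}{1-(1-\rho)^{\mathsf m}},\qquad \omega\in\mathbb N_0,$$ where $\alpha_\omega=\omega \bmod \mathsf m$ and $\beta_\omega=\lfloor \omega/\mathsf m\rfloor$.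
   Context: Time is measured in slots of unit duration. There are $\mathsf n$ nodes sharing a channel to a common sink. At each slot every node independently becomes active with probability $\rho$ and generates an update time-stamped with the start of that slot. Under IRSA, time is divided into frames of $\mathsf m$ slots. A node that became active at least once during a frame transmits, over the next frame, only its most recently generated update (as several replicas in randomly chosen slots of the frame, decoded at the sink at the end of the frame by successive interference cancellation). There are no retransmissions. A transmitted update is decoded with probability $1-\mathsf P_l$, where $\mathsf P_l$ is the packet loss rate. The channel load is $\mathsf G=\mathsf n[1-(1-\rho)^{\mathsf m}]/\mathsf m$ and the aggregate throughput (average number of decoded packets per slot) is $\mathsf S=\mathsf G(1-\mathsf P_l)$. The current age of information of a node is $\delta(t)=t-\sigma(t)$, where $\sigma(t)$ is the time-stamp of the last update received from that node by time $t$. It grows linearly with slope 1 inside each frame $[k\mathsf m,(k+1)\mathsf m)$. At the end of each frame, independently over frames, an update of the node is delivered with probability $\xi:=[1-(1-\rho)^{\mathsf m}](1-\mathsf P_l)=\mathsf m\mathsf S/\mathsf n$. If it is delivered, the age is reset to $\mathsf m+B$, where $B\in\{1,\dots,\mathsf m\}$ is the number of slots between the generation of the update and the start of the frame in which it is sent, with probability mass function $$p_B(b)=\frac{\rho(1-\rho)^{b-1}}{1-(1-\rho)^{\mathsf m}}.$$ If it is not delivered, the age is not reset. Time $t=0$ is set right after the reception of the first update, so $\delta(0)\in\{\mathsf m+1,\dots,2\mathsf m\}$. Accordingly, $\Omega_k$ is a Markov chain with one-step transition probabilities, for every $i\in\mathbb N_0$, $$q_{(i,j)}=\begin{cases}\xi\,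 p_B(j+1) & j\in\{0,\dots,\mathsf m-1\}\\ 1-\xi & j=i+\mathsf m\\ 0&\text{otherwise.}\end{cases}$$ *)

theory Defs
  imports "HOL-Probability.Probability"
begin

section \<open>Markov chains given by a transition matrix\<close>

definition transition_matrix :: "('s \<Rightarrow> 's \<Rightarrow> real) \<Rightarrow> bool" where
  "transition_matrix p \<longleftrightarrow> (\<forall>i j. 0 \<le> p i j) \<and> (\<forall>i. (p i has_sum 1) UNIV)"

definition markov_chain ::
  "'a measure \<Rightarrow> (nat \<Rightarrow> 'a \<Rightarrow> 's) \<Rightarrow> ('s \<Rightarrow> 's \<Rightarrow> real) \<Rightarrow> bool" where
  "markov_chain M X p \<longleftrightarrow>
     prob_space M \<and> transition_matrix p \<and>
     (\<forall>k. X k \<in> M \<rightarrow>\<^sub>M count_space UNIV) \<and>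
     (\<forall>k h j. \<P>(x in M. \<forall>l\<le>k. X l x = h l) > 0 \<longrightarrow>
        \<P>(x in M. X (Suc k) x = j \<bar> \<forall>l\<le>k. X l x = h l) = p (h k) j)"

(* For a transition matrix all the families summed below are dominated by p i, hence summable,
   so infsum never takes its default value. *)
fun n_step :: "('s \<Rightarrow> 's \<Rightarrow> real) \<Rightarrow> nat \<Rightarrow> 's \<Rightarrow> 's \<Rightarrow> real" where
  "n_step p 0 i j = of_bool (i = j)"
| "n_step p (Suc n) i j = (\<Sum>\<^sub>\<infinity>l. p i l * n_step p n l j)"

(* Probability that the chain started in i visits j for the first time after time 0 at time n. *)
fun first_passage :: "('s \<Rightarrow> 's \<Rightarrow> real) \<Rightarrow> nat \<Rightarrow> 's \<Rightarrow> 's \<Rightarrow> real" where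
  "first_passage p 0 i j = 0"
| "first_passage p (Suc 0) i j = p i j"
| "first_passage p (Suc (Suc n)) i j = (\<Sum>\<^sub>\<infinity>l\<in>- {j}. p i l * first_passage p (Suc n) l j)"

definition irreducible_chain :: "('s \<Rightarrow> 's \<Rightarrow> real) \<Rightarrow> bool" where
  "irreducible_chain p \<longleftrightarrow> (\<forall>i j. \<exists>n. n_step p n i j > 0)"

definition aperiodic_chain :: "('s \<Rightarrow> 's \<Rightarrow> real) \<Rightarrow> bool" where
  "aperiodic_chain p \<longleftrightarrow> (\<forall>i. Gcd {n. n > 0 \<and> n_step p n i i > 0} = 1)"

(* Return to i is almost sure and the mean return time is finite. *)
definition positive_recurrent_chain :: "('s \<Rightarrow> 's \<Rightarrow> real) \<Rightarrow> bool" where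
  "positive_recurrent_chain p \<longleftrightarrow>
     (\<forall>i. (\<lambda>n. first_passage p n i i) sums 1 \<and>
          summable (\<lambda>n. real n * first_passage p n i i))"

definition ergodic_chain :: "('s \<Rightarrow> 's \<Rightarrow> real) \<Rightarrow> bool" where
  "ergodic_chain p \<longleftrightarrow>
     irreducible_chain p \<and> aperiodic_chain p \<and> positive_recurrent_chain p"

definition stationary_distribution :: "('s \<Rightarrow> 's \<Rightarrow> real) \<Rightarrow> ('s \<Rightarrow> real) \<Rightarrow> bool" where
  "stationary_distribution p \<pi> \<longleftrightarrow>
     (\<forall>i. 0 \<le> \<pi> i) \<and> (\<pi> has_sum 1) UNIV \<and> (\<forall>j. ((\<lambda>i. \<pi> i * p i j) has_sum \<pi> j) UNIV)"

(* The limit clause determines \<pi>, so there is at most one steady-state distribution. *)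
definition steady_state_distribution :: "('s \<Rightarrow> 's \<Rightarrow> real) \<Rightarrow> ('s \<Rightarrow> real) \<Rightarrow> bool" where
  "steady_state_distribution p \<pi> \<longleftrightarrow>
     stationary_distribution p \<pi> \<and> (\<forall>i j. (\<lambda>n. n_step p n i j) \<longlonglongrightarrow> \<pi> j)"


section \<open>Age of information of a node under IRSA\<close>

(* n: number of nodes, m: slots per frame, \<rho>: activation probability, Pl: packet loss rate. *)

definition channel_load :: "nat \<Rightarrow> nat \<Rightarrow> real \<Rightarrow> real" where
  "channel_load n m \<rho> = real n * (1 - (1 - \<rho>) ^ m) / real m"

definition throughput :: "nat \<Rightarrow> nat \<Rightarrow> real \<Rightarrow> real \<Rightarrow> real" where
  "throughput n m \<rho> Pl = channel_load n m \<rho> * (1 - Pl)"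

definition delivery_prob :: "nat \<Rightarrow> real \<Rightarrow> real \<Rightarrow> real" where
  "delivery_prob m \<rho> Pl = (1 - (1 - \<rho>) ^ m) * (1 - Pl)"

definition p_B :: "nat \<Rightarrow> real \<Rightarrow> nat \<Rightarrow> real" where
  "p_B m \<rho> b = (if b \<in> {1..m} then \<rho> * (1 - \<rho>) ^ (b - 1) / (1 - (1 - \<rho>) ^ m) else 0)"

definition offset_transition :: "nat \<Rightarrow> real \<Rightarrow> real \<Rightarrow> nat \<Rightarrow> nat \<Rightarrow> real" where
  "offset_transition m \<rho> Pl i j =
     (if j < m then delivery_prob m \<rho> Pl * p_B m \<rho> (j + 1)
      else if j = i + m then 1 - delivery_prob m \<rho> Pl
      else 0)"

(* The updates received from the node are recorded as a sequence u: at time k * m, the end of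
   the frame that starts at (k - 1) * m, either nothing is received (u k = None), or an update
   generated b slots before the start of that frame is received (u k = Some b).  The first
   update is received at time 0, so u 0 is never None and the maximum below exists for t >= 0. *)

definition last_reception :: "nat \<Rightarrow> (nat \<Rightarrow> nat option) \<Rightarrow> real \<Rightarrow> nat" where
  "last_reception m u t = (GREATEST k. real (k * m) \<le> t \<and> u k \<noteq> None)"

definition last_time_stamp :: "nat \<Rightarrow> (nat \<Rightarrow> nat option) \<Rightarrow> real \<Rightarrow> real" where
  "last_time_stamp m u t =
     (let k = last_reception m u t in (real k - 1) * real m - real (the (u k)))"

definition age :: "nat \<Rightarrow> (nat \<Rightarrow> nat option) \<Rightarrow> real \<Rightarrow> real" where
  "age m u t = t - last_time_stamp m u t"

(* The conversion to nat loses nothing, see of_nat_age_offset. *)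
definition age_offset :: "nat \<Rightarrow> (nat \<Rightarrow> nat option) \<Rightarrow> nat \<Rightarrow> nat" where
  "age_offset m u k = nat \<lfloor>age m u (real (k * m)) - real (m + 1)\<rfloor>"

lemma last_reception_0: "m \<ge> 1 \<Longrightarrow> u 0 \<noteq> None \<Longrightarrow> last_reception m u 0 = 0"
  unfolding last_reception_def
  by (rule Greatest_equality) (auto simp flip: of_nat_mult)

lemma last_reception_Suc:
  assumes "m \<ge> 1" "u 0 \<noteq> None"
  shows "last_reception m u (real (Suc k * m)) =
     (if u (Suc k) = None then last_reception m u (real (k * m)) else Suc k)"
proof -
  have *: "real (l * m) \<le> real (k * m) \<longleftrightarrow> l \<le> k" for l k
    using assms(1) by (simp only: of_nat_le_iff mult_le_cancel2) auto
  show ?thesis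
  proof (cases "u (Suc k) = None")
    case True
    then have "(l \<le> Suc k \<and> u l \<noteq> None) = (l \<le> k \<and> u l \<noteq> None)" for l
      by (metis le_SucE le_Suc_eq)
    then show ?thesis using True unfolding last_reception_def * by simp
  next
    case False
    then show ?thesis unfolding last_reception_def *
      by (auto intro!: Greatest_equality)
  qed
qed

lemma age_0:
  assumes "m \<ge> 1" "u 0 = Some b"
  shows "age m u 0 = real (m + b)"
  using assms by (simp add: age_def last_time_stamp_def last_reception_0)

lemma age_Suc:
  assumes "m \<ge> 1" "u 0 \<noteq> None"
  shows "age m u (real (Suc k * m)) =
     (case u (Suc k) of None \<Rightarrow> age m u (real (k * m)) + real m | Some b \<Rightarrow> real (m + b))"
  unfolding age_def last_time_stamp_def last_reception_Suc[of m u, OF assms] Let_def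
  by (cases "u (Suc k)") (auto simp: algebra_simps)

lemma of_nat_age_offset:
  assumes "m \<ge> 1" "u 0 \<noteq> None" "\<And>k b. u k = Some b \<Longrightarrow> b \<ge> 1"
  shows "real (age_offset m u k) = age m u (real (k * m)) - real (m + 1)"
proof -
  have "\<exists>w::nat. age m u (real (k * m)) - real (m + 1) = real w"
  proof (induction k)
    case 0
    obtain b where b: "u 0 = Some b" using assms(2) by auto
    have "b \<ge> 1" using assms(3)[OF b] .
    then show ?case using age_0[of m u b] assms(1) b
      by (intro exI[of _ "b - 1"]) (auto simp: of_nat_diff)
  next
    case (Suc k)
    then obtain w where w: "age m u (real (k * m)) - real (m + 1) = real w" by auto
    show ?case
    proof (cases "u (Suc k)")
      case None
      then show ?thesis using w age_Suc[of m u k, OF assms(1,2)]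
        by (intro exI[of _ "w + m"]) auto
    next
      case (Some b)
      then have "b \<ge> 1" using assms(3) by blast
      then show ?thesis using Some age_Suc[of m u k, OF assms(1,2)]
        by (intro exI[of _ "b - 1"]) (auto simp: of_nat_diff)
    qed
  qed
  then show ?thesis unfolding age_offset_def by fastforce
qed

end

theory Submission
  imports Defs
begin

text \<open>
  A delivery erases the past, and the offset then records how many frames have passed since: it is
  \<open>b * m + a\<close> if \<open>b\<close> failures have followed the last delivery and the delivered update was
  generated \<open>a + 1\<close> slots before its frame. Hence the \<open>k\<close>-step probability of reaching \<open>w\<close> does not merely converge: it equals
  the limit from every starting state as soon as \<open>k > w div m\<close>. Irreducibility and aperiodicity are
  immediate; positive recurrence follows because \<open>w\<close> is reached within a fixed number of steps with
  a probability bounded below uniformly in the current state, which bounds the sum of the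
  probabilities of not having returned by time \<open>k\<close>, that is, the mean return time.
\<close>

section \<open>General transition matrices: taboo probabilities and positive recurrence\<close>

text \<open>Probability that the chain started in \<open>i\<close> avoids \<open>j\<close> at times \<open>1, \<dots>, n\<close>.\<close>

fun taboo :: "('s \<Rightarrow> 's \<Rightarrow> real) \<Rightarrow> nat \<Rightarrow> 's \<Rightarrow> 's \<Rightarrow> real" where
  "taboo p 0 i j = 1"
| "taboo p (Suc n) i j = (\<Sum>\<^sub>\<infinity>l\<in>- {j}. p i l * taboo p n l j)"

context
  fixes p :: "'s \<Rightarrow> 's \<Rightarrow> real"
  assumes p: "transition_matrix p"
begin

lemma transition_nonneg: "0 \<le> p i j"
  using p by (simp add: transition_matrix_def)

lemma transition_has_sum: "(p i has_sum 1) UNIV"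
  using p by (simp add: transition_matrix_def)

lemma transition_summable: "p i summable_on A"
  using transition_has_sum summable_on_subset_banach[of "p i" UNIV A]
  by (auto simp: summable_on_def)

lemma transition_infsum_le: "infsum (p i) A \<le> 1"
  using infsum_mono2[OF transition_summable transition_summable, of A UNIV i]
    transition_nonneg infsumI[OF transition_has_sum[of i]] by simp

text \<open>Domination by the row \<open>p i\<close> gives the summability on which the comparisons
  of infinite sums below rely.\<close>

lemma transition_mult_summable:
  assumes "\<And>l. l \<in> A \<Longrightarrow> g l \<in> {0..1}"
  shows "(\<lambda>l. p i l * g l) summable_on A"
  using assms
  by (intro summable_on_comparison_test[OF transition_summable[of i A]])
     (auto simp: transition_nonneg intro: mult_left_le)

lemma transition_infsum_bounds:
  assumes "\<And>l. l \<in> A \<Longrightarrow> g l \<in> {0..1}"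
  shows "(\<Sum>\<^sub>\<infinity>l\<in>A. p i l * g l) \<in> {0..1}"
proof -
  have "(\<Sum>\<^sub>\<infinity>l\<in>A. p i l * g l) \<le> infsum (p i) A"
    using assms by (intro infsum_mono transition_mult_summable transition_summable)
      (auto simp: transition_nonneg intro: mult_left_le)
  moreover have "0 \<le> (\<Sum>\<^sub>\<infinity>l\<in>A. p i l * g l)"
    using assms by (intro infsum_nonneg) (auto simp: transition_nonneg)
  ultimately show ?thesis using transition_infsum_le[of i A] by simp
qed

lemma n_step_bounds: "n_step p n i j \<in> {0..1}"
proof (induction n arbitrary: i)
  case (Suc n)
  then show ?case unfolding n_step.simps by (intro transition_infsum_bounds)
qed auto

lemma taboo_bounds: "taboo p n i j \<in> {0..1}"
proof (induction n arbitrary: i)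
  case (Suc n)
  then show ?case unfolding taboo.simps by (intro transition_infsum_bounds)
qed auto

lemma taboo_summable: "(\<lambda>l. p i l * taboo p n l j) summable_on A"
  by (intro transition_mult_summable taboo_bounds)

lemma transition_infsum_Compl: "infsum (p i) (- {j}) = 1 - p i j"
proof -
  have "infsum (p i) UNIV = infsum (p i) ({j} \<union> - {j})" by (simp add: Un_commute)
  also have "\<dots> = infsum (p i) {j} + infsum (p i) (- {j})"
    by (intro infsum_Un_disjoint transition_summable) auto
  finally show ?thesis using infsumI[OF transition_has_sum[of i]] by simp
qed

lemma transition_infsum_diff:
  assumes "\<And>l. f l \<in> {0..1}" "\<And>l. g l \<in> {0..1}"
  shows "(\<Sum>\<^sub>\<infinity>l\<in>A. p i l * (f l - g l)) = (\<Sum>\<^sub>\<infinity>l\<in>A. p i l * f l) - (\<Sum>\<^sub>\<infinity>l\<in>A. p i l * g l)"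
proof -
  have "(\<Sum>\<^sub>\<infinity>l\<in>A. p i l * (f l - g l)) = (\<Sum>\<^sub>\<infinity>l\<in>A. p i l * f l + - (p i l * g l))"
    by (simp add: algebra_simps)
  also have "\<dots> = (\<Sum>\<^sub>\<infinity>l\<in>A. p i l * f l) + (\<Sum>\<^sub>\<infinity>l\<in>A. - (p i l * g l))"
    using assms
    by (intro infsum_add transition_mult_summable summable_on_uminus[THEN iffD2]) auto
  finally show ?thesis by (simp add: infsum_uminus)
qed

text \<open>A first visit at time \<open>Suc n\<close> means that \<open>j\<close> is avoided for
  \<open>n\<close> steps but not for one more. This turns sums of first-passage probabilities into
  telescoping sums.\<close>

lemma first_passage_eq_taboo: "first_passage p (Suc n) i j = taboo p n i j - taboo p (Suc n) i j"
proof (induction n arbitrary: i)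
  case 0
  then show ?case by (simp add: transition_infsum_Compl)
next
  case (Suc n)
  show ?case
    unfolding first_passage.simps Suc
    by (subst transition_infsum_diff) (rule taboo_bounds, rule taboo_bounds, simp)
qed

lemma n_step_Suc_0: "n_step p (Suc 0) i j = p i j"
proof -
  have "(\<Sum>\<^sub>\<infinity>l. p i l * of_bool (l = j)) = (\<Sum>\<^sub>\<infinity>l\<in>{j}. p i l)"
    by (intro infsum_cong_neutral) auto
  then show ?thesis by simp
qed

text \<open>Avoiding \<open>j\<close> up to a time excludes being in \<open>j\<close> at that
  time.\<close>

lemma taboo_le_n_step: "taboo p (Suc n) i j \<le> 1 - n_step p (Suc n) i j"
proof (induction n arbitrary: i)
  case 0
  then show ?case
    using transition_infsum_Compl[of i j] by (simp add: n_step_Suc_0 del: n_step.simps)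
next
  case (Suc n)
  define g where "g l = n_step p (Suc n) l j" for l
  have g: "1 - g l \<in> {0..1}" "g l \<in> {0..1}" for l
    using n_step_bounds[of "Suc n" l j] by (auto simp: g_def)
  \<comment> \<open>The sum is extended from \<open>- {j}\<close> to all states; the added term at
    \<open>j\<close> is nonnegative.\<close>
  have "taboo p (Suc (Suc n)) i j \<le> (\<Sum>\<^sub>\<infinity>l. p i l * (1 - g l))"
    unfolding taboo.simps(2)[of p "Suc n"] using g Suc transition_nonneg
    by (intro infsum_mono_neutral taboo_summable transition_mult_summable)
       (auto intro!: mult_left_mono simp: g_def simp del: taboo.simps n_step.simps)
  also have "\<dots> = 1 - (\<Sum>\<^sub>\<infinity>l. p i l * g l)"
    using g transition_infsum_diff[of "\<lambda>_. 1" g] infsumI[OF transition_has_sum] by simp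
  finally show ?case by (simp add: g_def)
qed

text \<open>Wherever the chain is after \<open>n\<close> steps, the next \<open>Suc N\<close> steps
  hit \<open>j\<close> with probability at least \<open>c\<close>. The induction peels off the first
  \<open>n\<close> steps, leaving \<open>taboo_le_n_step\<close> as its base.\<close>

lemma taboo_add_le:
  assumes "\<And>l. n_step p (Suc N) l j \<ge> c"
  shows "taboo p (n + Suc N) i j \<le> (1 - c) * taboo p n i j"
proof (induction n arbitrary: i)
  case 0
  show ?case using taboo_le_n_step[of N i j] assms[of i] by (simp del: taboo.simps(2) n_step.simps)
next
  case (Suc n)
  have "p i l * taboo p (n + Suc N) l j \<le> (1 - c) * (p i l * taboo p n l j)" for l
    using mult_left_mono[OF Suc transition_nonneg] by (simp add: mult.left_commute)
  then have "taboo p (Suc n + Suc N) i j \<le> (\<Sum>\<^sub>\<infinity>l\<in>- {j}. (1 - c) * (p i l * taboo p n l j))"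
    unfolding taboo.simps add_Suc by (intro infsum_mono taboo_summable summable_on_cmult_right)
  then show ?case by (simp add: infsum_cmult_right')
qed

lemma taboo_antimono: "taboo p (Suc n) i j \<le> taboo p n i j"
proof (induction n arbitrary: i)
  case 0
  then show ?case using taboo_bounds[of "Suc 0" i j] by simp
next
  case (Suc n)
  then show ?case
    unfolding taboo.simps(2)[of p _ i] using transition_nonneg
    by (intro infsum_mono taboo_summable) (auto intro!: mult_left_mono simp del: taboo.simps)
qed

lemma first_passage_nonneg: "0 \<le> first_passage p n i j"
  using taboo_antimono by (cases n) (simp_all add: first_passage_eq_taboo del: taboo.simps)

text \<open>The first \<open>Suc N\<close> terms are at most 1 each, and by
  \<open>taboo_add_le\<close> the shifted terms sum to at most \<open>1 - c\<close> times the
  original sum \<open>s\<close>. Solving \<open>s \<le> Suc N + (1 - c) * s\<close> gives a bound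
  independent of \<open>n\<close>.\<close>

lemma sum_taboo_le:
  assumes c: "c > 0" "\<And>l. n_step p (Suc N) l j \<ge> c"
  shows "(\<Sum>k<n. taboo p k i j) \<le> real (Suc N) / c"
proof -
  let ?t = "\<lambda>k. taboo p k i j"
  have "sum ?t {..<n} \<le> sum ?t {..<Suc N + n}"
    using taboo_bounds by (intro sum_mono2) auto
  also have "\<dots> = sum ?t {..<Suc N} + (\<Sum>k<n. ?t (k + Suc N))"
    by (induction n) (simp_all add: add_ac del: taboo.simps)
  also have "\<dots> \<le> real (Suc N) + (1 - c) * sum ?t {..<n}"
  proof (intro add_mono)
    show "sum ?t {..<Suc N} \<le> real (Suc N)"
      using sum_bounded_above[of "{..<Suc N}" ?t 1] taboo_bounds by simp
    show "(\<Sum>k<n. ?t (k + Suc N)) \<le> (1 - c) * sum ?t {..<n}"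
      using taboo_add_le[OF c(2)] unfolding sum_distrib_left by (intro sum_mono)
  qed
  finally show ?thesis using c(1) by (simp add: field_simps)
qed

text \<open>Doeblin's condition, localized at the target state \<open>j\<close>.\<close>

lemma positive_recurrent_if_uniformly_reached:
  assumes c: "c > 0" "\<And>l. n_step p (Suc N) l j \<ge> c"
  shows "(\<lambda>n. first_passage p n i j) sums 1"
    and "summable (\<lambda>n. real n * first_passage p n i j)"
proof -
  let ?t = "\<lambda>k. taboo p k i j" and ?f = "\<lambda>k. first_passage p k i j"
  have t_nonneg: "0 \<le> ?t k" for k
    using taboo_bounds[of k i j] by simp
  have "(\<Sum>k\<le>n. ?t k) \<le> real (Suc N) / c" for n
    using sum_taboo_le[OF c] by (simp only: flip: lessThan_Suc_atMost)
  then have "summable ?t"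
    using t_nonneg by (intro bounded_imp_summable)
  then have t0: "?t \<longlonglongrightarrow> 0"
    by (rule summable_LIMSEQ_zero)
  \<comment> \<open>The differences are the first-passage probabilities; they telescope from
    \<open>?t 0 = 1\<close> to the limit 0.\<close>
  have "(\<lambda>n. ?t n - ?t (Suc n)) sums (?t 0 - 0)"
    using t0 by (rule telescope_sums')
  then have "(\<lambda>n. ?f (Suc n)) sums 1"
    by (simp add: first_passage_eq_taboo del: taboo.simps(2))
  then show "?f sums 1"
    by (subst (asm) sums_Suc_iff) simp
  \<comment> \<open>Summation by parts: the truncated mean return time becomes a sum of taboo
    probabilities minus a nonnegative boundary term.\<close>
  have parts: "(\<Sum>k<Suc n. real k * ?f k) = (\<Sum>k<n. ?t k) - real n * ?t n" for n
    by (induction n) (simp_all add: first_passage_eq_taboo algebra_simps del: taboo.simps)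
  have "(\<Sum>k\<le>n. real k * ?f k) \<le> real (Suc N) / c" for n
  proof -
    have "(\<Sum>k\<le>n. real k * ?f k) = (\<Sum>k<n. ?t k) - real n * ?t n"
      using parts[of n] by (simp only: lessThan_Suc_atMost)
    also have "\<dots> \<le> (\<Sum>k<n. ?t k)"
      using t_nonneg[of n] by simp
    finally show ?thesis using sum_taboo_le[OF c, of i n] by linarith
  qed
  then show "summable (\<lambda>n. real n * ?f n)"
    using first_passage_nonneg by (intro bounded_imp_summable) auto
qed

end

section \<open>The offset chain: multi-step probabilities, ergodicity and stationarity\<close>

locale irsa =
  fixes m :: nat and \<rho> Pl :: real
  assumes m: "m \<ge> 1" and \<rho>: "0 < \<rho>" "\<rho> < 1" and Pl: "0 \<le> Pl" "Pl < 1"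
begin

abbreviation \<xi> where "\<xi> \<equiv> delivery_prob m \<rho> Pl"
abbreviation q where "q \<equiv> offset_transition m \<rho> Pl"

text \<open>The claimed law with \<open>\<xi>\<close> in place of \<open>m * S / n\<close>: a
  geometric number of failures since the last delivery, independent of the generation delay.\<close>

definition steady :: "nat \<Rightarrow> real" where
  "steady w = \<xi> * (1 - \<xi>) ^ (w div m) * p_B m \<rho> (w mod m + 1)"

lemma activity_prob: "0 < 1 - (1 - \<rho>) ^ m" "1 - (1 - \<rho>) ^ m < 1"
  using m \<rho> by (auto simp: power_less_one_iff)

lemma delivery_prob_pos: "0 < \<xi>"
  unfolding delivery_prob_def using activity_prob Pl by simp

lemma delivery_prob_less_1: "\<xi> < 1"
proof -
  have "\<xi> \<le> 1 - (1 - \<rho>) ^ m"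
    unfolding delivery_prob_def using activity_prob Pl by (intro mult_left_le) auto
  then show ?thesis using activity_prob by linarith
qed

lemma p_B_pos: "j < m \<Longrightarrow> 0 < p_B m \<rho> (j + 1)"
  using activity_prob \<rho> by (simp add: p_B_def)

lemma sum_p_B: "(\<Sum>j<m. p_B m \<rho> (j + 1)) = 1"
proof -
  have "(\<Sum>j<m. p_B m \<rho> (j + 1)) = (\<Sum>j<m. \<rho> * (1 - \<rho>) ^ j / (1 - (1 - \<rho>) ^ m))"
    by (intro sum.cong) (auto simp: p_B_def)
  also have "\<dots> = \<rho> * (\<Sum>j<m. (1 - \<rho>) ^ j) / (1 - (1 - \<rho>) ^ m)"
    by (simp add: sum_distrib_left sum_divide_distrib)
  also have "\<rho> * (\<Sum>j<m. (1 - \<rho>) ^ j) = 1 - (1 - \<rho>) ^ m"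
    using \<rho> by (simp add: sum_gp_strict)
  finally show ?thesis using activity_prob by simp
qed

lemma steady_pos: "0 < steady w"
  unfolding steady_def using delivery_prob_pos delivery_prob_less_1 p_B_pos[of "w mod m"] m
  by (intro mult_pos_pos) auto

lemma steady_less: "j < m \<Longrightarrow> steady j = \<xi> * p_B m \<rho> (j + 1)"
  by (simp add: steady_def)

lemma steady_add: "steady (j + m) = (1 - \<xi>) * steady j"
  using m by (simp add: steady_def)

text \<open>A row has at most \<open>m + 1\<close> nonzero entries, so every infinite sum against it
  is finite. This yields both the row sums and the recursion for \<open>n_step\<close>.\<close>

lemma offset_transition_mult_has_sum:
  "((\<lambda>l. q i l * g l) has_sum (\<Sum>l<m. \<xi> * p_B m \<rho> (l + 1) * g l) + (1 - \<xi>) * g (i + m)) UNIV"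
proof (rule has_sum_finite_neutralI)
  show "(\<Sum>l<m. \<xi> * p_B m \<rho> (l + 1) * g l) + (1 - \<xi>) * g (i + m) =
      (\<Sum>l\<in>insert (i + m) {..<m}. q i l * g l)"
    by (simp add: offset_transition_def)
qed (auto simp: offset_transition_def)

lemma transition_matrix_offset: "transition_matrix q"
  unfolding transition_matrix_def
proof (intro conjI allI)
  show "0 \<le> q i j" for i j
    using delivery_prob_pos delivery_prob_less_1 p_B_pos[of j] m
    by (auto simp: offset_transition_def)
  show "(q i has_sum 1) UNIV" for i
    using offset_transition_mult_has_sum[of i "\<lambda>_. 1"] sum_p_B
    by (simp flip: sum_distrib_left)
qed

text \<open>If \<open>b\<close> failures have followed the last delivery, then \<open>j div m = b\<close>; so \<open>j div m < k\<close>
  identifies the paths with a delivery in the first \<open>k\<close> steps.\<close>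

lemma n_step_offset:
  "n_step q k i j =
     (if j div m < k then steady j else if j = i + k * m then (1 - \<xi>) ^ k else 0)"
proof (induction k arbitrary: i)
  case 0
  then show ?case by auto
next
  case (Suc k)
  let ?g = "\<lambda>l. n_step q k l j"
  have step: "n_step q (Suc k) i j = (\<Sum>l<m. \<xi> * p_B m \<rho> (l + 1) * ?g l) + (1 - \<xi>) * ?g (i + m)"
    using offset_transition_mult_has_sum[THEN infsumI] by simp
  \<comment> \<open>An initial failure followed by \<open>k\<close> more ends beyond block
    \<open>k\<close>, so it contributes nothing when \<open>j div m = k\<close>.\<close>
  have far: "(i + m + k * m) div m > k" for i
    using m by (simp add: div_add1_eq)
  consider "j div m < k" | "j div m = k" | "j div m > k" by linarith
  then show ?case
  proof cases
    case 1
    have "(\<Sum>l<m. \<xi> * p_B m \<rho> (l + 1) * steady j) = \<xi> * steady j"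
      using sum_p_B by (simp flip: sum_distrib_left sum_distrib_right)
    then show ?thesis unfolding step using 1 by (simp add: Suc algebra_simps)
  next
    \<comment> \<open>The only contributing path is a delivery to \<open>j mod m\<close> in the
      first step followed by \<open>k\<close> failures.\<close>
    case 2
    then have j: "j = j mod m + k * m" by (metis mod_div_mult_eq)
    have g: "?g l = (if l = j mod m then (1 - \<xi>) ^ k else 0)" if "l < m" for l
      using 2 j by (auto simp: Suc)
    have "(\<Sum>l<m. \<xi> * p_B m \<rho> (l + 1) * ?g l) =
        (\<Sum>l<m. if l = j mod m then \<xi> * p_B m \<rho> (l + 1) * (1 - \<xi>) ^ k else 0)"
      by (intro sum.cong) (auto simp: g)
    also have "\<dots> = steady j"
      using m 2 by (simp add: steady_def)
    finally show ?thesis unfolding step using 2 far[of i] by (auto simp: Suc)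
  next
    \<comment> \<open>After a delivery in the first step, \<open>k\<close> further steps cannot pass
      block \<open>k\<close>; only uninterrupted failure can reach \<open>j\<close>.\<close>
    case 3
    have "(l + k * m) div m = k" if "l < m" for l using that m by simp
    then have "?g l = 0" if "l < m" for l
      using 3 that by (auto simp: Suc)
    then show ?thesis unfolding step using 3 by (auto simp: Suc add_ac)
  qed
qed

lemma n_step_offset_eventually: "w div m < k \<Longrightarrow> n_step q k i w = steady w"
  by (simp add: n_step_offset)

lemma ergodic_offset: "ergodic_chain q"
  unfolding ergodic_chain_def
proof (intro conjI)
  show "irreducible_chain q"
    unfolding irreducible_chain_def
    using steady_pos n_step_offset_eventually by (metis lessI)
  show "aperiodic_chain q"
    unfolding aperiodic_chain_def
  proof
    fix i
    let ?A = "{k. k > 0 \<and> n_step q k i i > 0}" and ?k = "Suc (i div m)"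
    \<comment> \<open>Two consecutive return times force the gcd to divide 1.\<close>
    have "?k \<in> ?A" "Suc ?k \<in> ?A"
      using steady_pos[of i] by (simp_all add: n_step_offset_eventually del: n_step.simps)
    then have "Gcd ?A dvd ?k" "Gcd ?A dvd Suc ?k"
      by (blast intro: Gcd_dvd)+
    then have "Gcd ?A dvd Suc ?k - ?k" by (rule dvd_diff_nat[rotated])
    then show "Gcd ?A = 1" by simp
  qed
  show "positive_recurrent_chain q"
    unfolding positive_recurrent_chain_def
  proof (intro allI)
    fix i
    have "steady i \<le> n_step q (Suc (i div m)) l i" for l
      by (simp add: n_step_offset_eventually del: n_step.simps)
    from positive_recurrent_if_uniformly_reached[OF transition_matrix_offset steady_pos this]
    show "(\<lambda>k. first_passage q k i i) sums 1 \<and> summable (\<lambda>k. real k * first_passage q k i i)"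
      by blast
  qed
qed

text \<open>Division with remainder identifies offsets with pairs of a block and a residue, over
  which the mass is a product of a geometric law and \<open>p_B\<close>.\<close>

lemma steady_has_sum: "(steady has_sum 1) UNIV"
proof -
  have "(\<lambda>b. \<xi> * (1 - \<xi>) ^ b) sums (\<xi> * (1 / (1 - (1 - \<xi>))))"
    using delivery_prob_pos delivery_prob_less_1 by (intro sums_mult geometric_sums) auto
  then have geom: "((\<lambda>b. \<xi> * (1 - \<xi>) ^ b) has_sum 1) UNIV"
    using delivery_prob_pos delivery_prob_less_1 by (intro sums_nonneg_imp_has_sum) auto
  define f where "f = (\<lambda>(b, a). \<xi> * (1 - \<xi>) ^ b * p_B m \<rho> (a + 1))"
  have f_nonneg: "0 \<le> f x" if "x \<in> UNIV \<times> {..<m}" for x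
    using that delivery_prob_pos delivery_prob_less_1 p_B_pos
    by (auto simp: f_def intro!: mult_nonneg_nonneg less_imp_le)
  have row: "((\<lambda>a. f (b, a)) has_sum \<xi> * (1 - \<xi>) ^ b) {..<m}" for b
    using sum_p_B by (auto simp: f_def simp flip: sum_distrib_left intro!: has_sum_finiteI)
  have "(f has_sum 1) (UNIV \<times> {..<m})"
    using row geom f_nonneg
    by (intro has_sum_SigmaI summable_on_SigmaI) (auto simp: summable_on_def)
  moreover have "bij_betw (\<lambda>w. (w div m, w mod m)) UNIV (UNIV \<times> {..<m})"
    using m by (intro bij_betw_byWitness[where f' = "\<lambda>(b, a). b * m + a"]) auto
  ultimately have "((\<lambda>w. f (w div m, w mod m)) has_sum 1) UNIV"
    by (subst has_sum_reindex_bij_betw)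
  then show ?thesis by (simp add: f_def steady_def[abs_def])
qed

text \<open>For \<open>j < m\<close> the column of \<open>q\<close> is constantly
  \<open>steady j\<close>; otherwise its only nonzero entry is in row \<open>j - m\<close>.\<close>

lemma stationary_steady: "((\<lambda>i. steady i * q i j) has_sum steady j) UNIV"
proof (cases "j < m")
  case True
  then have "q i j = steady j" for i
    by (simp add: offset_transition_def steady_less)
  then show ?thesis using has_sum_cmult_left[OF steady_has_sum, of "steady j"] by simp
next
  case False
  have "steady (j - m) * q (j - m) j = steady j"
    using False steady_add[of "j - m"] by (simp add: offset_transition_def)
  then show ?thesis using False
    by (intro has_sum_finite_neutralI[where B = "{j - m}"]) (auto simp: offset_transition_def)
qed

lemma steady_state_offset: "steady_state_distribution q steady"
  unfolding steady_state_distribution_def stationary_distribution_def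
proof (intro conjI allI)
  show "(\<lambda>k. n_step q k i j) \<longlonglongrightarrow> steady j" for i j
    using n_step_offset_eventually
    by (intro tendsto_eventually eventually_mono[OF eventually_gt_at_top[of "j div m"]])
qed (auto intro: steady_has_sum stationary_steady less_imp_le[OF steady_pos])

end

section \<open>Pathwise recursion of the age offset, and independence of past and next frame\<close>

lemma age_offset_0:
  assumes "m \<ge> 1" "u 0 \<noteq> None"
  shows "age_offset m u 0 = the (u 0) - 1"
  using assms by (auto simp: age_offset_def age_0)

lemma age_offset_Suc:
  assumes "m \<ge> 1" "u 0 \<noteq> None" "\<And>k b. u k = Some b \<Longrightarrow> b \<ge> 1"
  shows "age_offset m u (Suc k) =
     (case u (Suc k) of None \<Rightarrow> age_offset m u k + m | Some b \<Rightarrow> b - 1)"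
proof -
  have "real (age_offset m u (Suc k)) =
      real (case u (Suc k) of None \<Rightarrow> age_offset m u k + m | Some b \<Rightarrow> b - 1)"
    using of_nat_age_offset[of m u "Suc k", OF assms] of_nat_age_offset[of m u k, OF assms]
      age_Suc[of m u k, OF assms(1,2)] assms(3)[of "Suc k"]
    by (auto split: option.split)
  then show ?thesis by (simp only: of_nat_eq_iff)
qed

text \<open>Offsets up to \<open>k\<close> depend only on receptions up to \<open>k\<close>. This is
  the form in which independence from the next frame can be applied.\<close>

lemma age_offset_restrict:
  assumes "m \<ge> 1" "u 0 \<noteq> None" "\<And>k b. u k = Some b \<Longrightarrow> b \<ge> 1"
  assumes "l \<le> k"
  shows "age_offset m (\<lambda>i. if i \<le> k then u i else None) l = age_offset m u l"
  using \<open>l \<le> k\<close>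
proof (induction l)
  case 0
  then show ?case using assms by (simp add: age_offset_0)
next
  case (Suc l)
  then show ?case using assms
    by (subst (1 2) age_offset_Suc) (auto split: option.split if_splits)
qed

text \<open>The predicate \<open>F\<close> expresses \<open>P\<close> through the variables up to
  \<open>k\<close> alone. These are independent of \<open>Y (Suc k)\<close>, and arbitrary
  \<open>F\<close> and \<open>B\<close> are admissible because countable values make finite products
  discrete.\<close>

lemma (in prob_space) indep_vars_past_next:
  fixes Y :: "nat \<Rightarrow> 'a \<Rightarrow> 'b::countable"
  assumes Y: "indep_vars (\<lambda>_. count_space UNIV) Y UNIV"
    and past: "\<And>x y. \<lbrakk>x \<in> space M; \<And>l. l \<le> k \<Longrightarrow> y l = Y l x\<rbrakk> \<Longrightarrow> P x \<longleftrightarrow> F y"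
  shows "\<P>(x in M. P x \<and> Y (Suc k) x \<in> B) = \<P>(x in M. P x) * \<P>(x in M. Y (Suc k) x \<in> B)"
proof -
  let ?C = "\<lambda>_::nat. count_space (UNIV :: 'b set)"
  have "indep_var (PiM {..k} ?C) (\<lambda>x. restrict (\<lambda>l. Y l x) {..k})
      (PiM {Suc k} ?C) (\<lambda>x. restrict (\<lambda>l. Y l x) {Suc k})"
    by (rule indep_var_restrict[OF Y]) auto
  moreover have PiM: "PiM J ?C = count_space (PiE J (\<lambda>_. UNIV))" if "finite J" for J
    using that by (intro count_space_PiM_finite) auto
  ultimately have "prob ((\<lambda>x. (restrict (\<lambda>l. Y l x) {..k}, restrict (\<lambda>l. Y l x) {Suc k})) -`
        ({y \<in> PiE {..k} (\<lambda>_. UNIV). F y} \<times> {y \<in> PiE {Suc k} (\<lambda>_. UNIV). y (Suc k) \<in> B}) \<inter> space M) =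
      prob ((\<lambda>x. restrict (\<lambda>l. Y l x) {..k}) -` {y \<in> PiE {..k} (\<lambda>_. UNIV). F y} \<inter> space M) *
      prob ((\<lambda>x. restrict (\<lambda>l. Y l x) {Suc k}) -` {y \<in> PiE {Suc k} (\<lambda>_. UNIV). y (Suc k) \<in> B} \<inter> space M)"
    by (intro indep_varD) (auto simp: PiM)
  moreover have "P x \<longleftrightarrow> F (restrict (\<lambda>l. Y l x) {..k})" if "x \<in> space M" for x
    using that by (intro past) auto
  then have "(\<lambda>x. (restrict (\<lambda>l. Y l x) {..k}, restrict (\<lambda>l. Y l x) {Suc k})) -`
        ({y \<in> PiE {..k} (\<lambda>_. UNIV). F y} \<times> {y \<in> PiE {Suc k} (\<lambda>_. UNIV). y (Suc k) \<in> B}) \<inter> space M =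
      {x \<in> space M. P x \<and> Y (Suc k) x \<in> B}"
    "(\<lambda>x. restrict (\<lambda>l. Y l x) {..k}) -` {y \<in> PiE {..k} (\<lambda>_. UNIV). F y} \<inter> space M =
      {x \<in> space M. P x}"
    "(\<lambda>x. restrict (\<lambda>l. Y l x) {Suc k}) -` {y \<in> PiE {Suc k} (\<lambda>_. UNIV). y (Suc k) \<in> B} \<inter> space M =
      {x \<in> space M. Y (Suc k) x \<in> B}"
    by auto
  ultimately show ?thesis by simp
qed

section \<open>The offset process of a node and its law\<close>

locale irsa_node = irsa m \<rho> Pl + prob_space M
  for m :: nat and \<rho> Pl :: real and M :: "'a measure" +
  fixes U :: "nat \<Rightarrow> 'a \<Rightarrow> nat option"
  assumes indep_U: "indep_vars (\<lambda>_. count_space UNIV) U UNIV"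
    and U_0: "\<And>x. x \<in> space M \<Longrightarrow> U 0 x \<noteq> None"
    and U_range: "\<And>k x b. x \<in> space M \<Longrightarrow> U k x = Some b \<Longrightarrow> b \<in> {1..m}"
    and prob_U: "\<And>k. k \<ge> 1 \<Longrightarrow> \<P>(x in M. U k x \<noteq> None) = delivery_prob m \<rho> Pl"
    and cond_prob_U: "\<And>k b. k \<ge> 1 \<Longrightarrow> b \<in> {1..m} \<Longrightarrow>
           \<P>(x in M. U k x = Some b \<bar> U k x \<noteq> None) = p_B m \<rho> b"
begin

abbreviation \<Omega> where "\<Omega> k x \<equiv> age_offset m (\<lambda>l. U l x) k"

lemma U_measurable [measurable]: "U k \<in> M \<rightarrow>\<^sub>M count_space UNIV"
  using indep_U by (simp add: indep_vars_def)

lemma \<Omega>_0: "x \<in> space M \<Longrightarrow> \<Omega> 0 x = the (U 0 x) - 1"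
  using m U_0 by (intro age_offset_0) auto

lemma \<Omega>_Suc:
  "x \<in> space M \<Longrightarrow> \<Omega> (Suc k) x = (case U (Suc k) x of None \<Rightarrow> \<Omega> k x + m | Some b \<Rightarrow> b - 1)"
  using m U_0 U_range by (intro age_offset_Suc) auto

lemma \<Omega>_measurable [measurable]: "\<Omega> k \<in> M \<rightarrow>\<^sub>M count_space UNIV"
proof (induction k)
  case 0
  have "(\<lambda>x. the (U 0 x) - 1) \<in> M \<rightarrow>\<^sub>M count_space UNIV" by measurable
  then show ?case by (subst measurable_cong[OF \<Omega>_0])
next
  case (Suc k)
  note [measurable] = Suc
  have "(\<lambda>x. case U (Suc k) x of None \<Rightarrow> \<Omega> k x + m | Some b \<Rightarrow> b - 1) \<in> M \<rightarrow>\<^sub>M count_space UNIV"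
    by measurable
  then show ?case by (subst measurable_cong[OF \<Omega>_Suc])
qed

lemma \<Omega>_cong:
  assumes "x \<in> space M" "l \<le> k" "\<And>l. l \<le> k \<Longrightarrow> y l = U l x"
  shows "age_offset m (\<lambda>i. if i \<le> k then y i else None) l = \<Omega> l x"
proof -
  have "(\<lambda>i. if i \<le> k then y i else None) = (\<lambda>i. if i \<le> k then U i x else None)"
    using assms(3) by auto
  then show ?thesis
    using age_offset_restrict[of m "\<lambda>l. U l x" l k] m U_0[OF assms(1)] U_range[OF assms(1)] assms(2)
    by auto
qed

text \<open>The time-dependent predicate \<open>R\<close> serves two purposes: prescribing the whole
  history for the Markov property, or only the current offset for the marginal law.\<close>

lemma prob_past_next:
  "\<P>(x in M. (\<forall>l\<le>k. R l (\<Omega> l x)) \<and> U (Suc k) x \<in> B) =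
     \<P>(x in M. \<forall>l\<le>k. R l (\<Omega> l x)) * \<P>(x in M. U (Suc k) x \<in> B)"
proof (rule indep_vars_past_next[OF indep_U,
    where F = "\<lambda>y. \<forall>l\<le>k. R l (age_offset m (\<lambda>i. if i \<le> k then y i else None) l)"])
  fix x and y :: "nat \<Rightarrow> nat option"
  assume "x \<in> space M" "\<And>l. l \<le> k \<Longrightarrow> y l = U l x"
  then show "(\<forall>l\<le>k. R l (\<Omega> l x)) =
      (\<forall>l\<le>k. R l (age_offset m (\<lambda>i. if i \<le> k then y i else None) l))"
    using \<Omega>_cong[of x _ k y] by auto
qed

lemma prob_U_None: "\<P>(x in M. U (Suc k) x = None) = 1 - \<xi>"
  using prob_U[of "Suc k"] prob_neg[of "\<lambda>x. U (Suc k) x = None"] by simp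

lemma prob_U_Some:
  assumes "j < m"
  shows "\<P>(x in M. U (Suc k) x = Some (j + 1)) = \<xi> * p_B m \<rho> (j + 1)"
proof -
  have "\<P>(x in M. U (Suc k) x = Some (j + 1) \<bar> U (Suc k) x \<noteq> None) =
      \<P>(x in M. U (Suc k) x = Some (j + 1)) / \<xi>"
    unfolding cond_prob_def using prob_U[of "Suc k"]
    by (intro arg_cong2[where f = "(/)"] arg_cong[where f = prob]) auto
  then show ?thesis
    using assms delivery_prob_pos cond_prob_U[of "Suc k" "j + 1"] by (simp add: field_simps)
qed

text \<open>An offset below \<open>m\<close> reveals a delivery, since a failure adds
  \<open>m\<close>. As \<open>b \<ge> 1\<close>, the truncated \<open>b - 1\<close> determines
  \<open>b\<close>.\<close>

lemma \<Omega>_Suc_eq_iff: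
  assumes "x \<in> space M"
  shows "\<Omega> (Suc k) x = j \<longleftrightarrow>
    (if j < m then U (Suc k) x = Some (j + 1) else U (Suc k) x = None \<and> j = \<Omega> k x + m)"
  using \<Omega>_Suc[OF assms, of k] U_range[OF assms, of "Suc k"]
  by (cases "U (Suc k) x") auto

text \<open>Reaching \<open>w\<close> with \<open>w div m < k\<close> requires a delivery at one of
  the times \<open>1, ..., k\<close>, so the law of \<open>U 0\<close> does not enter. The induction
  strips the final failures one by one until the last delivery.\<close>

lemma prob_\<Omega>_eq_steady: "w div m < k \<Longrightarrow> \<P>(x in M. \<Omega> k x = w) = steady w"
proof (induction k arbitrary: w)
  case (Suc k)
  show ?case
  proof (cases "w < m")
    case True
    then have "\<P>(x in M. \<Omega> (Suc k) x = w) = \<P>(x in M. U (Suc k) x = Some (w + 1))"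
      by (simp add: \<Omega>_Suc_eq_iff cong: conj_cong)
    then show ?thesis using True prob_U_Some by (simp add: steady_less)
  next
    case False
    then have "\<P>(x in M. \<Omega> (Suc k) x = w) =
        \<P>(x in M. (\<forall>l\<le>k. l = k \<longrightarrow> \<Omega> l x = w - m) \<and> U (Suc k) x \<in> {None})"
      by (intro arg_cong[where f = prob] Collect_cong)
        (simp add: \<Omega>_Suc_eq_iff cong: conj_cong, auto)
    also have "\<dots> = \<P>(x in M. \<Omega> k x = w - m) * (1 - \<xi>)"
      using prob_past_next[of k "\<lambda>l v. l = k \<longrightarrow> v = w - m" "{None}"] prob_U_None by simp
    also have "\<dots> = steady w"
      using False Suc.IH[of "w - m"] Suc.prems m steady_add[of "w - m"]
      by (simp add: div_if)
    finally show ?thesis .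
  qed
qed simp

lemma markov_chain_\<Omega>: "markov_chain M \<Omega> q"
  unfolding markov_chain_def
proof (intro conjI allI impI)
  fix k h j
  assume pos: "\<P>(x in M. \<forall>l\<le>k. \<Omega> l x = h l) > 0"
  \<comment> \<open>On the conditioning event the current offset is \<open>h k\<close>, so moving to
    \<open>j\<close> is a condition on the next reception only.\<close>
  define B where "B = (if j < m then {Some (j + 1)} else if j = h k + m then {None} else {})"
  have "\<P>(x in M. \<Omega> (Suc k) x = j \<and> (\<forall>l\<le>k. \<Omega> l x = h l)) =
      \<P>(x in M. (\<forall>l\<le>k. \<Omega> l x = h l) \<and> U (Suc k) x \<in> B)"
    by (intro arg_cong[where f = prob] Collect_cong)
      (simp add: \<Omega>_Suc_eq_iff B_def cong: conj_cong, auto)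
  also have "\<dots> = \<P>(x in M. \<forall>l\<le>k. \<Omega> l x = h l) * \<P>(x in M. U (Suc k) x \<in> B)"
    by (rule prob_past_next)
  also have "\<P>(x in M. U (Suc k) x \<in> B) = q (h k) j"
    using prob_U_None prob_U_Some by (simp add: B_def offset_transition_def)
  finally show "\<P>(x in M. \<Omega> (Suc k) x = j \<bar> \<forall>l\<le>k. \<Omega> l x = h l) = q (h k) j"
    using pos by (simp add: cond_prob_def)
qed (auto intro: prob_space_axioms transition_matrix_offset \<Omega>_measurable)

end

theorem proposition1:
  fixes n m :: nat and \<rho> Pl :: real
    and M :: "'a measure" and U :: "nat \<Rightarrow> 'a \<Rightarrow> nat option"
  assumes "n \<ge> 1" and "m \<ge> 1" and "0 < \<rho>" and "\<rho> < 1" and "0 \<le> Pl" and "Pl < 1"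
    and "prob_space M"
    and "prob_space.indep_vars M (\<lambda>_. count_space UNIV) U UNIV"
    and "\<And>x. x \<in> space M \<Longrightarrow> U 0 x \<noteq> None"
    and "\<And>k x b. x \<in> space M \<Longrightarrow> U k x = Some b \<Longrightarrow> b \<in> {1..m}"
    and "\<And>k. k \<ge> 1 \<Longrightarrow> \<P>(x in M. U k x \<noteq> None) = delivery_prob m \<rho> Pl"
    and "\<And>k b. k \<ge> 1 \<Longrightarrow> b \<in> {1..m} \<Longrightarrow>
           \<P>(x in M. U k x = Some b \<bar> U k x \<noteq> None) = p_B m \<rho> b"
  shows "let S = throughput n m \<rho> Pl;
             q = offset_transition m \<rho> Pl;
             \<Omega> = (\<lambda>k x. age_offset m (\<lambda>l. U l x) k);
             \<pi> = (\<lambda>w. real m * S / real n * (1 - real m * S / real n) ^ (w div m)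
                       * (\<rho> * (1 - \<rho>) ^ (w mod m) / (1 - (1 - \<rho>) ^ m)))
         in markov_chain M \<Omega> q
          \<and> ergodic_chain q
          \<and> steady_state_distribution q \<pi>
          \<and> (\<forall>w. (\<lambda>k. \<P>(x in M. \<Omega> k x = w)) \<longlonglongrightarrow> \<pi> w)"
proof -
  interpret prob_space M by fact
  interpret irsa_node m \<rho> Pl M U
    using assms by unfold_locales auto
  \<comment> \<open>The factors \<open>n\<close> and \<open>m\<close> cancel, turning the stated
    formula into \<open>steady\<close>.\<close>
  have "real m * throughput n m \<rho> Pl / real n = \<xi>"
    using \<open>n \<ge> 1\<close> \<open>m \<ge> 1\<close> by (simp add: throughput_def channel_load_def delivery_prob_def)
  moreover have "\<rho> * (1 - \<rho>) ^ (w mod m) / (1 - (1 - \<rho>) ^ m) = p_B m \<rho> (w mod m + 1)" for w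
    using \<open>m \<ge> 1\<close> by (simp add: p_B_def Suc_le_eq)
  moreover have "(\<lambda>k. \<P>(x in M. \<Omega> k x = w)) \<longlonglongrightarrow> steady w" for w
    using prob_\<Omega>_eq_steady
    by (intro tendsto_eventually eventually_mono[OF eventually_gt_at_top[of "w div m"]])
  ultimately show ?thesis
    using markov_chain_\<Omega> ergodic_offset steady_state_offset
    unfolding Let_def by (simp only: steady_def[symmetric]) simp
qed

end
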